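(* Let $sE-A\in\mathbb{K}[s]^{n\times m}$ be a matrix pencil such that $A=DQ$ and $E^*Q=Q^*E$ for some dissipative matrix $D\in\mathbb{K}^{n\times n}$ and some $Q\in\mathbb{K}^{n\times m}$. If, additionally, $D+D^*=0$ and $\dim\operatorname{ran}\begin{bmatrix}E\\ Q\end{bmatrix}=n$, then $sE-A$ is port-Hamiltonian in the sense of Maschke and van der Schaft; in particular, for $\mathcal{L}:=\operatorname{ran}\begin{bmatrix}E\\ Q\end{bmatrix}$ and $\mathcal{D}:=\operatorname{gr}D$, the relation $\mathcal{D}$ is skew-adjoint, the relation $\mathcal{L}$ is self-adjoint, and $\operatorname{ran}\begin{bmatrix}E\\ A\end{bmatrix}=\mathcal{D}\mathcal{L}$.
   Context: $\mathbb{K}\in\{\mathbb{R},\mathbb{C}\}$, and $\mathbb{K}^n$ carries the inner product $\langle x,y\rangle=y^*x$. A square matrix $D$ is dissipative if $D+D^*\le0$ (negative semi-definite). A linear relation in $\mathbb{K}^n$ is a linear subspace of $\mathbb{K}^{2n}\cong\mathbb{K}^n\times\mathbb{K}^n$. The graph of $M\in\mathbb{K}^{n\times n}$ is $\operatorname{gr}M=\{(x,Mx):x\in\mathbb{K}^n\}$. The product is $\mathcal{D}\mathcal{L}=\{(x,z) : \exists y\in\mathbb{K}^n,\ (x,y)\in\mathcal{L},\ (y,z)\in\mathcal{D}\}$. The adjoint is $\mathcal{M}^*=\{(x,y)\in\mathbb{K}^{2n} : \langle w,x\rangle=\langle v,y\rangle\ \forall (v,w)\in\mathcal{M}\}$.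 With $-\mathcal{M}=\{(x,-y):(x,y)\in\mathcal{M}\}$, $\mathcal{M}$ is self-adjoint if $\mathcal{M}=\mathcal{M}^*$ and skew-adjoint if $\mathcal{M}=-\mathcal{M}^*$. A pencil $sE-A\in\mathbb{K}[s]^{n\times m}$ is port-Hamiltonian in the sense of Maschke and van der Schaft if $\operatorname{ran}\begin{bmatrix}E\\ A\end{bmatrix}=\mathcal{D}\mathcal{L}$ for some skew-adjoint linear relation $\mathcal{D}\subseteq\mathbb{K}^{2n}$ and some self-adjoint linear relation $\mathcal{L}\subseteq\mathbb{K}^{2n}$. *)

theory Defs
  imports "HOL-Analysis.Analysis" "Jordan_Normal_Form.Conjugate"
begin

text \<open>
  All notions are defined over a field with a conjugation, so that they can be used both for
  \<^typ>\<open>real\<close> (where \<^const>\<open>conjugate\<close> is the identity) and for \<^typ>\<open>complex\<close> (where it is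
  \<^const>\<open>cnj\<close>).  The space of pairs below carries the componentwise scalar multiplication;
  its subspaces and dimensions are taken over the field \<open>'k\<close> itself, not over the reals.
\<close>

interpretation pair_vec: finite_dimensional_vector_space_prod
  "(*s) :: 'k::field \<Rightarrow> 'k ^ 'n \<Rightarrow> 'k ^ 'n" "(*s) :: 'k \<Rightarrow> 'k ^ 'm \<Rightarrow> 'k ^ 'm"
  cart_basis cart_basis
  by unfold_locales

definition conj_inner :: "'k::conjugatable_field ^ 'n \<Rightarrow> 'k ^ 'n \<Rightarrow> 'k" where
  "conj_inner x y = (\<Sum>i\<in>UNIV. conjugate (y $ i) * x $ i)"

definition conj_transpose :: "'k::conjugatable_field ^ 'm ^ 'n \<Rightarrow> 'k ^ 'n ^ 'm" where
  "conj_transpose M = (\<chi> i j. conjugate (M $ j $ i))"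

text \<open>
  On \<^typ>\<open>complex\<close>, \<open>z \<le> 0\<close> is the order of \<^theory>\<open>HOL-Library.Complex_Order\<close>: \<open>z\<close> is real
  and nonpositive.
\<close>

definition negative_semidefinite :: "'k::conjugatable_ordered_field ^ 'n ^ 'n \<Rightarrow> bool" where
  "negative_semidefinite M \<longleftrightarrow> conj_transpose M = M \<and> (\<forall>x. conj_inner (M *v x) x \<le> 0)"

definition dissipative :: "'k::conjugatable_ordered_field ^ 'n ^ 'n \<Rightarrow> bool" where
  "dissipative D \<longleftrightarrow> negative_semidefinite (D + conj_transpose D)"

type_synonym ('k, 'n) vec_rel = "(('k ^ 'n) \<times> ('k ^ 'n)) set"

definition linear_relation :: "('k::field, 'n::finite) vec_rel \<Rightarrow> bool" where
  "linear_relation M \<longleftrightarrow> pair_vec.p.subspace M"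

definition gr :: "'k::field ^ 'n ^ 'n \<Rightarrow> ('k, 'n) vec_rel" where
  "gr M = range (\<lambda>x. (x, M *v x))"

text \<open>The range of the block matrix with \<open>E\<close> stacked on top of \<open>A\<close>.\<close>

definition ran_stack :: "'k::field ^ 'm ^ 'n \<Rightarrow> 'k ^ 'm ^ 'n \<Rightarrow> ('k, 'n) vec_rel" where
  "ran_stack E A = range (\<lambda>x. (E *v x, A *v x))"

text \<open>The right factor acts first, as for operators, whereas \<open>O\<close> composes left to right.\<close>

definition rel_times :: "('k, 'n::finite) vec_rel \<Rightarrow> ('k, 'n) vec_rel \<Rightarrow> ('k, 'n) vec_rel" where
  "rel_times D L = L O D"

definition rel_adjoint :: "('k::conjugatable_field, 'n::finite) vec_rel \<Rightarrow> ('k, 'n) vec_rel" where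
  "rel_adjoint M = {(x, y). \<forall>(v, w)\<in>M. conj_inner w x = conj_inner v y}"

definition rel_neg :: "('k::field, 'n::finite) vec_rel \<Rightarrow> ('k, 'n) vec_rel" where
  "rel_neg M = {(x, - y) | x y. (x, y) \<in> M}"

definition self_adjoint :: "('k::conjugatable_field, 'n::finite) vec_rel \<Rightarrow> bool" where
  "self_adjoint M \<longleftrightarrow> M = rel_adjoint M"

definition skew_adjoint :: "('k::conjugatable_field, 'n::finite) vec_rel \<Rightarrow> bool" where
  "skew_adjoint M \<longleftrightarrow> M = rel_neg (rel_adjoint M)"

text \<open>The pencil \<open>s E - A\<close> is represented by its pair of coefficient matrices.\<close>

definition port_Hamiltonian_MvdS ::
    "'k::conjugatable_field ^ 'm ^ 'n \<Rightarrow> 'k ^ 'm ^ 'n \<Rightarrow> bool" where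
  "port_Hamiltonian_MvdS E A \<longleftrightarrow>
     (\<exists>D L. linear_relation D \<and> skew_adjoint D \<and> linear_relation L \<and> self_adjoint L \<and>
        ran_stack E A = rel_times D L)"

end

theory Submission
  imports Defs
begin

text \<open>
  Symmetry of \<open>Q\<^sup>* E\<close> says that \<open>L = ran [E; Q]\<close> is contained in its adjoint.  The adjoint is the
  orthogonal complement of \<open>L\<close> for a nondegenerate sesquilinear form on the \<open>2n\<close>-dimensional space
  of pairs, so its dimension is at most \<open>2n - dim L = n\<close>, and the inclusion is an equality.
\<close>

lemma conjugate_conj_inner: "conjugate (conj_inner x y) = conj_inner y x"
  by (simp add: conj_inner_def sum_conjugate conjugate_dist_mul mult.commute)

lemma conj_inner_add_left: "conj_inner (x + y) z = conj_inner x z + conj_inner y z"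
  by (simp add: conj_inner_def sum.distrib algebra_simps)

lemma conj_inner_add_right: "conj_inner x (y + z) = conj_inner x y + conj_inner x z"
  by (simp add: conj_inner_def sum.distrib algebra_simps conjugate_dist_add)

lemma conj_inner_scale_left: "conj_inner (c *s x) y = c * conj_inner x y"
  by (simp add: conj_inner_def sum_distrib_left algebra_simps)

lemma conj_inner_scale_right: "conj_inner x (c *s y) = conjugate c * conj_inner x y"
  by (simp add: conj_inner_def sum_distrib_left algebra_simps conjugate_dist_mul)

lemma conj_inner_zero [simp]: "conj_inner 0 y = 0" "conj_inner x 0 = 0"
  by (simp_all add: conj_inner_def)

lemma conj_inner_axis: "conj_inner (axis i 1) x = conjugate (x $ i)"
  by (simp add: conj_inner_def axis_def if_distrib cong: if_cong)

text \<open>Nondegeneracy: testing against the standard basis vectors recovers every coordinate up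
  to conjugation, which is injective.\<close>

lemma conj_inner_eqI:
  assumes "\<And>z. conj_inner z x = conj_inner z y"
  shows "x = y"
  using assms[of "axis _ 1"] by (simp add: conj_inner_axis vec_eq_iff)

lemma conj_inner_mult_left: "conj_inner (M *v x) y = conj_inner x (conj_transpose M *v y)"
proof -
  have "conj_inner (M *v x) y = (\<Sum>i\<in>UNIV. \<Sum>j\<in>UNIV. conjugate (y $ i) * (M $ i $ j * x $ j))"
    by (simp add: conj_inner_def matrix_vector_mult_def sum_distrib_left)
  also have "\<dots> = (\<Sum>j\<in>UNIV. \<Sum>i\<in>UNIV. conjugate (y $ i) * (M $ i $ j * x $ j))"
    by (rule sum.swap)
  also have "\<dots> = conj_inner x (conj_transpose M *v y)"
    by (simp add: conj_inner_def matrix_vector_mult_def conj_transpose_def sum_conjugate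
        conjugate_dist_mul sum_distrib_left mult_ac)
  finally show ?thesis .
qed

lemma skew_adjoint_gr:
  fixes D :: "'k::conjugatable_field ^ 'n ^ 'n"
  assumes "D + conj_transpose D = 0"
  shows "skew_adjoint (gr D)"
proof -
  have transpose: "conj_transpose D = - D"
    using assms by (simp add: eq_neg_iff_add_eq_0 add.commute)
  have minus: "(- D) *v x = - (D *v x)" for x
    by (simp add: matrix_vector_mult_def vec_eq_iff sum_negf)
  \<comment> \<open>Moving \<open>D\<close> across the inner product turns membership into an
    equality tested against all \<open>v\<close>; nondegeneracy then leaves only the graph of
    \<open>conj_transpose D\<close>, which is \<open>- D\<close>.\<close>
  have "rel_adjoint (gr D) = {(x, y). y = - (D *v x)}"
    unfolding rel_adjoint_def gr_def
    by (auto simp: conj_inner_mult_left transpose minus intro!: conj_inner_eqI)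
  then show ?thesis
    by (auto simp: skew_adjoint_def rel_neg_def gr_def)
qed

lemma linear_relation_ran_stack:
  fixes E A :: "'k::field ^ 'm ^ 'n"
  shows "linear_relation (ran_stack E A)"
  unfolding linear_relation_def pair_vec.p.subspace_def ran_stack_def
proof (intro conjI ballI allI)
  show "0 \<in> range (\<lambda>x. (E *v x, A *v x))"
    by (rule image_eqI[where x = 0]) (auto simp: zero_prod_def)
next
  fix p q assume "p \<in> range (\<lambda>x. (E *v x, A *v x))" "q \<in> range (\<lambda>x. (E *v x, A *v x))"
  then obtain x y where "p = (E *v x, A *v x)" "q = (E *v y, A *v y)" by auto
  then show "p + q \<in> range (\<lambda>x. (E *v x, A *v x))"
    by (intro image_eqI[where x = "x + y"]) (auto simp: matrix_vector_right_distrib)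
next
  fix c p assume "p \<in> range (\<lambda>x. (E *v x, A *v x))"
  then obtain x where "p = (E *v x, A *v x)" by auto
  then show "pair_vec.scale c p \<in> range (\<lambda>x. (E *v x, A *v x))"
    by (intro image_eqI[where x = "c *s x"])
      (auto simp: pair_vec.scale_def vector_scalar_commute)
qed

lemma linear_relation_gr: "linear_relation (gr D)"
  using linear_relation_ran_stack[of "mat 1" D] by (simp add: ran_stack_def gr_def)

text \<open>Each pair in \<open>M\<close> imposes a condition whose two sides are both additive and
  conjugate-linear in \<open>(x, y)\<close>. The set \<open>M\<close> is arbitrary, so singletons
  are covered too.\<close>

lemma linear_relation_rel_adjoint: "linear_relation (rel_adjoint M)"
  unfolding linear_relation_def pair_vec.p.subspace_def rel_adjoint_def
  by (fastforce simp: pair_vec.scale_def zero_prod_def conj_inner_add_right conj_inner_scale_right)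

text \<open>The form behind the adjoint is skew-Hermitian: exchanging its arguments conjugates the
  value and changes its sign, so its vanishing is symmetric.\<close>

lemma rel_adjoint_singleton_commute: "p \<in> rel_adjoint {q} \<longleftrightarrow> q \<in> rel_adjoint {p}"
proof -
  have "conj_inner w x = conj_inner v y \<longleftrightarrow> conj_inner y v = conj_inner x w"
    for v w x y :: "'a ^ 'b"
    using conjugate_cancel_iff[of "conj_inner w x" "conj_inner v y"]
    by (auto simp: conjugate_conj_inner)
  then show ?thesis
    by (cases p; cases q) (simp add: rel_adjoint_def)
qed

text \<open>The form is nondegenerate: pairs with \<open>v = 0\<close> detect \<open>x\<close>, and
  pairs with \<open>w = 0\<close> detect \<open>y\<close>.\<close>

lemma rel_adjoint_UNIV: "rel_adjoint UNIV = {0}"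
proof -
  have "x = 0 \<and> y = 0" if h: "\<And>v w. conj_inner w x = conj_inner v y" for x y :: "'a ^ 'b"
  proof
    show "x = 0" by (rule conj_inner_eqI) (use h[of _ 0] in simp)
    show "y = 0" by (rule conj_inner_eqI) (use h[of 0] in simp)
  qed
  then show ?thesis by (auto simp: rel_adjoint_def zero_prod_def)
qed

text \<open>Extend a basis \<open>B\<close> of \<open>L\<close> to a basis \<open>B'\<close> of the
  space of pairs. An element of the adjoint pairs to zero with \<open>B\<close>, so it is determined
  by its pairings with \<open>B' - B\<close>, which has \<open>2n - dim L\<close> elements.\<close>

lemma dim_rel_adjoint_le:
  fixes L :: "('k::conjugatable_field, 'n::finite) vec_rel"
  assumes "linear_relation L"
  shows "pair_vec.p.dim L + pair_vec.p.dim (rel_adjoint L) \<le> 2 * CARD('n)"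
proof -
  let ?scale = "pair_vec.scale :: 'k \<Rightarrow> ('k ^ 'n) \<times> ('k ^ 'n) \<Rightarrow> _"
  interpret pp: finite_dimensional_vector_space_pair_1 ?scale pair_vec.Basis_pair ?scale
    ..
  obtain B where B: "finite B" "B \<subseteq> L" "pair_vec.p.independent B" "card B = pair_vec.p.dim L"
    using pair_vec.p.basis_subspace_exists[OF assms[unfolded linear_relation_def]] by metis
  define B' where "B' = pair_vec.p.extend_basis B"
  have B': "B \<subseteq> B'" "pair_vec.p.independent B'" "pair_vec.p.span B' = UNIV"
    unfolding B'_def
    by (rule pair_vec.p.extend_basis_superset[OF B(3)]
        pair_vec.p.independent_extend_basis[OF B(3)] pair_vec.p.span_extend_basis[OF B(3)])+
  have fin: "finite B'"
    using B'(2) by (rule pair_vec.p.finiteI_independent)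
  have card_B': "card B' = 2 * CARD('n)"
  proof -
    have "card B' = pair_vec.p.dim (UNIV :: ('k, 'n) vec_rel)"
      using pair_vec.p.dim_eq_card[of B' UNIV] B' by simp
    also have "\<dots> = 2 * CARD('n)"
      using pair_vec.dim_Times[of "UNIV :: ('k ^ 'n) set" "UNIV :: ('k ^ 'n) set"]
      by (simp add: vec.dim_UNIV card_cart_basis)
    finally show ?thesis .
  qed
  \<comment> \<open>Here \<open>p\<close> occupies the left slots, where \<open>conj_inner\<close>
    is linear; in the condition for \<open>p \<in> rel_adjoint {b}\<close> it occupies the
    conjugate-linear ones. The symmetry of orthogonality reconciles the two in
    \<open>c_0_iff\<close>.\<close>
  define c where "c b p = conj_inner (fst p) (snd b) - conj_inner (snd p) (fst b)"
    for b p :: "('k ^ 'n) \<times> ('k ^ 'n)"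
  have c_0_iff: "c b p = 0 \<longleftrightarrow> p \<in> rel_adjoint {b}" for b p
    unfolding rel_adjoint_singleton_commute[of p]
    by (cases b; cases p) (auto simp: c_def rel_adjoint_def)
  have c_add: "c b (p + q) = c b p + c b q" for b p q
    by (simp add: c_def conj_inner_add_left)
  have c_scale: "c b (?scale r p) = r * c b p" for b r p
    by (simp add: c_def pair_vec.scale_def conj_inner_scale_left algebra_simps)
  \<comment> \<open>The pairings serve as coefficients of the added basis vectors themselves, so the
    target is a subspace of the same space and has dimension at most
    \<open>card (B' - B)\<close>.\<close>
  define f where "f p = (\<Sum>b\<in>B' - B. ?scale (c b p) b)" for p
  have lin: "Vector_Spaces.linear ?scale ?scale f"
    by unfold_locales
      (simp_all add: f_def c_add c_scale sum.distrib pair_vec.p.scale_sum_right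
        pair_vec.p.scale_left_distrib)
  have sub: "pair_vec.p.subspace (rel_adjoint L)"
    using linear_relation_rel_adjoint by (simp add: linear_relation_def)
  have "p = 0" if p: "p \<in> rel_adjoint L" and "f p = 0" for p
  proof -
    have "p \<in> rel_adjoint {b}" if "b \<in> B'" for b
    proof (cases "b \<in> B")
      case True
      then show ?thesis using p B(2) by (auto simp: rel_adjoint_def)
    next
      case False
      \<comment> \<open>Independence lets each coefficient \<open>c b p\<close> be read off as zero
        from \<open>f p = 0\<close>.\<close>
      have "pair_vec.p.independent (B' - B)"
        using B'(2) by (rule pair_vec.p.independent_mono) auto
      then have "c b p = 0"
        using pair_vec.p.independentD[of "B' - B" "B' - B" "\<lambda>b. c b p" b] fin that False
          \<open>f p = 0\<close> by (simp add: f_def)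
      then show ?thesis by (simp add: c_0_iff)
    qed
    \<comment> \<open>With the roles exchanged, orthogonality to the fixed \<open>p\<close> defines
      a subspace; containing the basis \<open>B'\<close>, it is everything, and nondegeneracy gives
      \<open>p = 0\<close>.\<close>
    then have "B' \<subseteq> rel_adjoint {p}"
      using rel_adjoint_singleton_commute by blast
    then have "UNIV \<subseteq> rel_adjoint {p}"
      using pair_vec.p.span_minimal[of B' "rel_adjoint {p}"]
        linear_relation_rel_adjoint[of "{p}"] B'(3)
      by (simp add: linear_relation_def)
    then have "p \<in> rel_adjoint {q}" for q
      using rel_adjoint_singleton_commute by blast
    then have "p \<in> rel_adjoint UNIV"
      by (auto simp: rel_adjoint_def)
    then show ?thesis by (simp add: rel_adjoint_UNIV)
  qed
  then have "inj_on f (rel_adjoint L)"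
    using pp.linear_inj_on_iff_eq_0[OF lin sub] by blast
  then have "pair_vec.p.dim (rel_adjoint L) = pair_vec.p.dim (f ` rel_adjoint L)"
    using pp.dim_image_eq[OF lin, of "rel_adjoint L"] pair_vec.p.span_eq_iff[THEN iffD2, OF sub]
    by simp
  also have "\<dots> \<le> card (B' - B)"
  proof (rule pair_vec.p.dim_le_card)
    show "f ` rel_adjoint L \<subseteq> pair_vec.p.span (B' - B)"
      unfolding f_def
      by (auto intro!: pair_vec.p.span_sum pair_vec.p.span_scale intro: pair_vec.p.span_base)
  qed (use fin in simp)
  also have "\<dots> = 2 * CARD('n) - pair_vec.p.dim L"
    using B B'(1) card_B' by (simp add: card_Diff_subset)
  finally show ?thesis
    \<comment> \<open>Subtraction on naturals truncates, so \<open>card B \<le> card B'\<close> is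
      needed to move \<open>dim L\<close> to the other side.\<close>
    using card_mono[OF fin B'(1)] B(4) card_B' by linarith
qed

text \<open>For the elements generated by \<open>v\<close> and \<open>x\<close>, moving
  \<open>Q\<close> and \<open>E\<close> to the right slot leaves \<open>conj_inner v\<close> applied
  to \<open>Q* E x\<close> and to \<open>E* Q x\<close>.\<close>

lemma ran_stack_subset_rel_adjoint:
  assumes "conj_transpose E ** Q = conj_transpose Q ** E"
  shows "ran_stack E Q \<subseteq> rel_adjoint (ran_stack E Q)"
  using assms
  by (auto simp: ran_stack_def rel_adjoint_def conj_inner_mult_left matrix_vector_mul_assoc)

lemma self_adjoint_ran_stack:
  fixes E Q :: "'k::conjugatable_field ^ 'm ^ 'n"
  assumes "conj_transpose E ** Q = conj_transpose Q ** E"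
    and "pair_vec.p.dim (ran_stack E Q) = CARD('n)"
  shows "self_adjoint (ran_stack E Q)"
  unfolding self_adjoint_def
proof (rule pair_vec.p.subspace_dim_equal)
  show "pair_vec.p.subspace (ran_stack E Q)"
    using linear_relation_ran_stack by (simp add: linear_relation_def)
  show "pair_vec.p.subspace (rel_adjoint (ran_stack E Q))"
    using linear_relation_rel_adjoint by (simp add: linear_relation_def)
  show "ran_stack E Q \<subseteq> rel_adjoint (ran_stack E Q)"
    using assms(1) by (rule ran_stack_subset_rel_adjoint)
  \<comment> \<open>The dimension hypothesis enters here: \<open>n\<close> plus the dimension of the
    adjoint is at most \<open>2n\<close>.\<close>
  show "pair_vec.p.dim (rel_adjoint (ran_stack E Q)) \<le> pair_vec.p.dim (ran_stack E Q)"
    using dim_rel_adjoint_le[OF linear_relation_ran_stack, of E Q] assms(2) by simp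
qed

lemma ran_stack_mult: "ran_stack E (D ** Q) = rel_times (gr D) (ran_stack E Q)"
  by (auto simp: ran_stack_def rel_times_def gr_def relcomp_unfold image_iff
      simp flip: matrix_vector_mul_assoc)

text \<open>Stated over any field with a conjugation, so that the real and the complex case are both
  instances.\<close>

lemma port_Hamiltonian_MvdS_skew:
  fixes E A Q :: "'k::conjugatable_field ^ 'm ^ 'n" and D :: "'k ^ 'n ^ 'n"
  assumes "A = D ** Q" "conj_transpose E ** Q = conj_transpose Q ** E"
    and "D + conj_transpose D = 0" "pair_vec.p.dim (ran_stack E Q) = CARD('n)"
  shows "port_Hamiltonian_MvdS E A \<and> skew_adjoint (gr D) \<and> self_adjoint (ran_stack E Q) \<and>
    ran_stack E A = rel_times (gr D) (ran_stack E Q)"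
proof -
  have "skew_adjoint (gr D)" "self_adjoint (ran_stack E Q)"
    "ran_stack E A = rel_times (gr D) (ran_stack E Q)"
    using skew_adjoint_gr[OF assms(3)] self_adjoint_ran_stack[OF assms(2,4)]
      ran_stack_mult[of E D Q] assms(1) by simp_all
  moreover from this have "port_Hamiltonian_MvdS E A"
    unfolding port_Hamiltonian_MvdS_def
    \<comment> \<open>The witnesses stay schematic; unification with the established facts, with
      backtracking, settles on \<open>gr D\<close> and \<open>ran_stack E Q\<close>.\<close>
    by (intro exI conjI) (rule linear_relation_gr linear_relation_ran_stack | assumption)+
  ultimately show ?thesis by simp
qed

theorem proposition4p5:
  shows
    "(\<forall>(E :: real ^ 'm ^ 'n) (A :: real ^ 'm ^ 'n) (D :: real ^ 'n ^ 'n) (Q :: real ^ 'm ^ 'n).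
        A = D ** Q \<and> conj_transpose E ** Q = conj_transpose Q ** E \<and> dissipative D \<and>
        D + conj_transpose D = 0 \<and> pair_vec.p.dim (ran_stack E Q) = CARD('n) \<longrightarrow>
        port_Hamiltonian_MvdS E A \<and>
        skew_adjoint (gr D) \<and> self_adjoint (ran_stack E Q) \<and>
        ran_stack E A = rel_times (gr D) (ran_stack E Q)) \<and>
     (\<forall>(E :: complex ^ 'm ^ 'n) (A :: complex ^ 'm ^ 'n) (D :: complex ^ 'n ^ 'n) (Q :: complex ^ 'm ^ 'n).
        A = D ** Q \<and> conj_transpose E ** Q = conj_transpose Q ** E \<and> dissipative D \<and>
        D + conj_transpose D = 0 \<and> pair_vec.p.dim (ran_stack E Q) = CARD('n) \<longrightarrow>
        port_Hamiltonian_MvdS E A \<and>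
        skew_adjoint (gr D) \<and> self_adjoint (ran_stack E Q) \<and>
        ran_stack E A = rel_times (gr D) (ran_stack E Q))"
  by (rule conjI; intro allI impI; elim conjE; rule port_Hamiltonian_MvdS_skew; assumption)

end
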